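(* Let $U$ and $V$ be Banach spaces, let $\mathcal{A}: U \to V^*$ be a (possibly nonlinear) operator with $\mathcal{A} \in \mathcal{C}^3(U,V^* )$, and let $J: U\to\mathbb{R}$ be a (possibly nonlinear) functional with $J \in \mathcal{C}^3(U,\mathbb{R})$. Let $u \in U$ satisfy $$\mathcal{A}(u)(v)=0 \quad \forall v \in V,$$ and let $z \in V$ satisfy $$\mathcal{A}'(u)(v,z)=J'(u)(v) \quad \forall v \in U.$$ Then for arbitrary fixed $\tilde{u} \in U$ and $\tilde{z} \in V$ it holds that $$J(u)-J(\tilde{u})= \frac{1}{2}\rho(\tilde{u})(z-\tilde{z})+\frac{1}{2}\rho^*(\tilde{u},\tilde{z})(u-\tilde{u}) -\rho (\tilde{u})(\tilde{z}) + \mathcal{R}^{(3)},$$ where $$\rho(\tilde{u})(\cdot) := -\mathcal{A}(\tilde{u})(\cdot), \qquad \rho^*(\tilde{u},\tilde{z})(\cdot) := J'(\tilde{u})(\cdot)-\mathcal{A}'(\tilde{u})(\cdot,\tilde{z}),$$ and, with $e:=u-\tilde{u}$ and $e^*:=z-\tilde{z}$, the remainder term is $$\mathcal{R}^{(3)}:=\frac{1}{2}\int_{0}^{1}\big[J'''(\tilde{u}+se)(e,e,e)-\mathcal{A}'''(\tilde{u}+se)(e,e,e,\tilde{z}+se^* )-3\mathcal{A}''(\tilde{u}+se)(e,e,e^* )\big]\,s(s-1)\,ds.$$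
   Context: $V^*$ is the dual space of $V$; for $w\in U$, $v\in V$, $\mathcal{A}(w)(v)$ denotes the value of the functional $\mathcal{A}(w)\in V^*$ at $v$. Primes denote Fréchet derivatives: $\mathcal{A}'(w)(q,v)$, $\mathcal{A}''(w)(q_1,q_2,v)$ and $\mathcal{A}'''(w)(q_1,q_2,q_3,v)$ are the first, second and third Fréchet derivatives of $\mathcal{A}$ at $w\in U$ in directions $q, q_1,q_2,q_3\in U$, evaluated at the element $v\in V$ (the last argument is always the argument of the resulting functional in $V^*$). Similarly $J'(w)(q)$ and $J'''(w)(q_1,q_2,q_3)$ denote the first and third Fréchet derivatives of $J$.
   Formalization: The term −ρ(ũ)(z̃) in the identity is corrected to +ρ(ũ)(z̃); with the printed sign the identity fails, e.g. for U=V=ℝ, A(w)(v)=(w−1)v, J(w)=w, u=z=z̃=1, ũ=0. *)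

theory Defs
  imports "HOL-Analysis.Analysis"
begin

text \<open>
  The dual space of \<open>'v\<close> is the type \<open>'v \<Rightarrow>\<^sub>L real\<close> of bounded linear functionals.
  The Frechet derivative is taken as a map into the normed space \<open>'a \<Rightarrow>\<^sub>L 'b\<close>, so that it can
  itself be differentiated; \<open>Blinfun\<close> is harmless because a Frechet derivative is bounded linear.
\<close>

definition fderiv :: "('a::real_normed_vector \<Rightarrow> 'b::real_normed_vector) \<Rightarrow> 'a \<Rightarrow> ('a \<Rightarrow>\<^sub>L 'b)"
  where "fderiv f x = Blinfun (frechet_derivative f (at x))"

lemma has_derivative_fderiv:
  assumes "f differentiable (at x)"
  shows "(f has_derivative blinfun_apply (fderiv f x)) (at x)"
  using assms frechet_derivative_works[of f "at x"]
  by (auto simp: fderiv_def bounded_linear_Blinfun_apply has_derivative_bounded_linear)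

lemma fderiv_eqI:
  assumes "(f has_derivative blinfun_apply D) (at x)"
  shows "fderiv f x = D"
  using frechet_derivative_at[OF assms, symmetric] by (simp add: fderiv_def blinfun_apply_inverse)

definition fderiv2 ::
  "('a::real_normed_vector \<Rightarrow> 'b::real_normed_vector) \<Rightarrow> 'a \<Rightarrow> ('a \<Rightarrow>\<^sub>L 'a \<Rightarrow>\<^sub>L 'b)"
  where "fderiv2 f = fderiv (fderiv f)"

definition fderiv3 ::
  "('a::real_normed_vector \<Rightarrow> 'b::real_normed_vector) \<Rightarrow> 'a \<Rightarrow> ('a \<Rightarrow>\<^sub>L 'a \<Rightarrow>\<^sub>L 'a \<Rightarrow>\<^sub>L 'b)"
  where "fderiv3 f = fderiv (fderiv2 f)"

text \<open>Continuity of \<open>f\<close> and of its lower derivatives follows from their differentiability.\<close>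

definition C3 :: "('a::real_normed_vector \<Rightarrow> 'b::real_normed_vector) \<Rightarrow> bool"
  where "C3 f \<longleftrightarrow>
    (\<forall>x. f differentiable (at x)) \<and>
    (\<forall>x. fderiv f differentiable (at x)) \<and>
    (\<forall>x. fderiv2 f differentiable (at x)) \<and>
    continuous_on UNIV (fderiv3 f)"

text \<open>
  Sign convention: with \<open>\<rho> = - A\<close> the error identity contains \<open>+ \<rho>(u')(z')\<close>. With \<open>- \<rho>(u')(z')\<close>, as
  printed in the source, it fails already for \<open>U = V = \<real>\<close>, \<open>A(w)(v) = (w - 1) * v\<close>, \<open>J(w) = w\<close>,
  \<open>u = z = z' = 1\<close>, \<open>u' = 0\<close>: both weighted residuals and the remainder vanish, \<open>J u - J u' = 1\<close>
  and \<open>\<rho>(u')(z') = 1\<close>.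
\<close>

definition primal_residual ::
  "('u::banach \<Rightarrow> ('v::banach \<Rightarrow>\<^sub>L real)) \<Rightarrow> 'u \<Rightarrow> 'v \<Rightarrow> real"
  where "primal_residual A w v = - A w v"

definition adjoint_residual ::
  "('u::banach \<Rightarrow> ('v::banach \<Rightarrow>\<^sub>L real)) \<Rightarrow> ('u \<Rightarrow> real) \<Rightarrow> 'u \<Rightarrow> 'v \<Rightarrow> 'u \<Rightarrow> real"
  where "adjoint_residual A J w y q = fderiv J w q - fderiv A w q y"

definition remainder3 ::
  "('u::banach \<Rightarrow> ('v::banach \<Rightarrow>\<^sub>L real)) \<Rightarrow> ('u \<Rightarrow> real) \<Rightarrow> 'u \<Rightarrow> 'v \<Rightarrow> 'u \<Rightarrow> 'v \<Rightarrow> real"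
  where "remainder3 A J u z u' z' =
    (let e = u - u'; es = z - z' in
      1 / 2 * integral {0..1} (\<lambda>s::real.
        (fderiv3 J (u' + s *\<^sub>R e) e e e
          - fderiv3 A (u' + s *\<^sub>R e) e e e (z' + s *\<^sub>R es)
          - 3 * fderiv2 A (u' + s *\<^sub>R e) e e es) * (s * (s - 1))))"

end

theory Submission
  imports Defs
begin

text \<open>
  Restrict the Lagrangian \<open>J w - A w y\<close> to the segment from \<open>(u', z')\<close> to \<open>(u, z)\<close>.
  Integrating its derivative over the segment by the trapezoidal rule gives the identity:
  the derivative vanishes at the endpoint \<open>(u, z)\<close>, is the sum of the two residuals at
  \<open>(u', z')\<close>, and the quadrature error is the remainder.
\<close>

text \<open>Two integrations by parts move derivatives from \<open>L3\<close> onto the kernel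
  \<open>s * (s - 1)\<close>. The kernel vanishes at 0 and 1, which removes \<open>L2\<close>; its
  derivative \<open>2 * s - 1\<close> equals -1 and 1 there, which produces the sum
  \<open>L1 0 + L1 1\<close>.\<close>

lemma trapezoidal_error:
  fixes L L1 L2 L3 :: "real \<Rightarrow> real"
  assumes "\<And>s. (L has_vector_derivative L1 s) (at s)"
    and "\<And>s. (L1 has_vector_derivative L2 s) (at s)"
    and "\<And>s. (L2 has_vector_derivative L3 s) (at s)"
  shows "L 1 - L 0 = 1 / 2 * (L1 0 + L1 1) + 1 / 2 * integral {0..1} (\<lambda>s. L3 s * (s * (s - 1)))"
proof -
  \<comment> \<open>\<open>G\<close> collects the boundary terms of both integrations by parts, so
    that all terms of its derivative cancel except the one with \<open>L3\<close>.\<close>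
  define G where "G s = 2 * L s - (2 * s - 1) * L1 s + s * (s - 1) * L2 s" for s
  have "(G has_vector_derivative L3 s * (s * (s - 1))) (at s within {0..1})" for s
    unfolding G_def has_real_derivative_iff_has_vector_derivative[symmetric]
    by (rule derivative_eq_intros assms[THEN has_real_derivative_iff_has_vector_derivative[THEN iffD2],
          THEN has_field_derivative_at_within] refl)+ (simp add: algebra_simps)
  then have "((\<lambda>s. L3 s * (s * (s - 1))) has_integral (G 1 - G 0)) {0..1}"
    \<comment> \<open>For the gauge integral, integrability of the derivative of \<open>G\<close>
      comes together with its value.\<close>
    by (intro fundamental_theorem_of_calculus) auto
  then have "integral {0..1} (\<lambda>s. L3 s * (s * (s - 1))) = G 1 - G 0"
    by (rule integral_unique)
  then show ?thesis
    by (simp add: G_def field_simps)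
qed

lemma has_vector_derivative_fderiv_line:
  assumes "f differentiable (at (a + s *\<^sub>R e))"
  shows "((\<lambda>s. f (a + s *\<^sub>R e)) has_vector_derivative fderiv f (a + s *\<^sub>R e) e) (at s)"
proof -
  have "((\<lambda>s. a + s *\<^sub>R e) has_derivative (\<lambda>h. h *\<^sub>R e)) (at s)"
    by (auto intro!: derivative_eq_intros)
  from has_derivative_compose[OF this has_derivative_fderiv[OF assms]]
  show ?thesis
    by (simp add: has_vector_derivative_def blinfun.scaleR_right)
qed

text \<open>Product rule for the bounded bilinear evaluation map. It serves terms such as
  \<open>A (w s) (y s)\<close>, where functional and argument both move along the segment.\<close>

lemma has_vector_derivative_blinfun_apply:
  assumes "(F has_vector_derivative F') (at s within S)"
    and "(y has_vector_derivative y') (at s within S)"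
  shows "((\<lambda>s. blinfun_apply (F s) (y s)) has_vector_derivative F s y' + F' (y s)) (at s within S)"
  using blinfun.has_vector_derivative[OF assms] .

lemma has_vector_derivative_blinfun_apply_const:
  assumes "(F has_vector_derivative F') (at s within S)"
  shows "((\<lambda>s. blinfun_apply (F s) x) has_vector_derivative F' x) (at s within S)"
  using has_vector_derivative_blinfun_apply[OF assms has_vector_derivative_const[of x]]
  by (simp add: blinfun.zero_right)

text \<open>Each order is \<open>fderiv\<close> of the one before, so one chain rule serves all
  three; the directions \<open>e\<close> already inserted are constant arguments.\<close>

lemma C3_has_vector_derivative_line:
  assumes "C3 f"
  shows "((\<lambda>s. f (a + s *\<^sub>R e)) has_vector_derivative fderiv f (a + s *\<^sub>R e) e) (at s)"
    and "((\<lambda>s. fderiv f (a + s *\<^sub>R e) e) has_vector_derivative fderiv2 f (a + s *\<^sub>R e) e e) (at s)"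
    and "((\<lambda>s. fderiv2 f (a + s *\<^sub>R e) e e) has_vector_derivative fderiv3 f (a + s *\<^sub>R e) e e e) (at s)"
  using assms unfolding C3_def fderiv3_def fderiv2_def[of f]
  by (auto intro!: has_vector_derivative_fderiv_line has_vector_derivative_blinfun_apply_const)

theorem theorem3p1:
  fixes A :: "'u::banach \<Rightarrow> ('v::banach \<Rightarrow>\<^sub>L real)"
    and J :: "'u \<Rightarrow> real"
    and u u' :: 'u
    and z z' :: 'v
  assumes "C3 A"
    and "C3 J"
    and "\<forall>v. A u v = 0"
    and "\<forall>v. fderiv A u v z = fderiv J u v"
  shows "J u - J u' =
    1 / 2 * primal_residual A u' (z - z')
    + 1 / 2 * adjoint_residual A J u' z' (u - u')
    + primal_residual A u' z'
    + remainder3 A J u z u' z'"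
proof -
  define e es where "e = u - u'" and "es = z - z'"
  define w y where "w s = u' + s *\<^sub>R e" and "y s = z' + s *\<^sub>R es" for s :: real
  define L where "L s = J (w s) - A (w s) (y s)" for s
  define L1 where "L1 s = fderiv J (w s) e - fderiv A (w s) e (y s) - A (w s) es" for s
  \<comment> \<open>As \<open>y\<close> is affine, each differentiation of a term in
    \<open>y s\<close> adds one term in \<open>es\<close> and \<open>y\<close> contributes no second
    derivative; hence the binomial factors 2 here and 3 in \<open>L3\<close>.\<close>
  define L2 where "L2 s = fderiv2 J (w s) e e - fderiv2 A (w s) e e (y s)
    - 2 * fderiv A (w s) e es" for s
  define L3 where "L3 s = fderiv3 J (w s) e e e - fderiv3 A (w s) e e e (y s)
    - 3 * fderiv2 A (w s) e e es" for s
  note dA = C3_has_vector_derivative_line[OF assms(1), of u' e, folded w_def]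
  note dJ = C3_has_vector_derivative_line[OF assms(2), of u' e, folded w_def]
  have dy: "(y has_vector_derivative es) (at s)" for s
    unfolding y_def by (auto intro!: derivative_eq_intros)
  note dAy = dA[THEN has_vector_derivative_blinfun_apply[OF _ dy]]
  note dAes = dA[THEN has_vector_derivative_blinfun_apply_const[of _ _ _ _ es]]
  have "(L has_vector_derivative L1 s) (at s)" for s
    using has_vector_derivative_diff[OF dJ(1) dAy(1)[of s]]
    by (simp add: L_def[abs_def] L1_def algebra_simps)
  moreover have "(L1 has_vector_derivative L2 s) (at s)" for s
    using has_vector_derivative_diff[OF has_vector_derivative_diff[OF dJ(2) dAy(2)] dAes(1)[of s]]
    by (simp add: L1_def[abs_def] L2_def algebra_simps)
  moreover have "(L2 has_vector_derivative L3 s) (at s)" for s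
    using has_vector_derivative_diff[OF has_vector_derivative_diff[OF dJ(3) dAy(3)]
        has_vector_derivative_mult_right[OF dAes(2)[of s], of 2]]
    by (simp add: L2_def[abs_def] L3_def algebra_simps)
  ultimately have "L 1 - L 0 = 1 / 2 * (L1 0 + L1 1)
      + 1 / 2 * integral {0..1} (\<lambda>s. L3 s * (s * (s - 1)))"
    by (rule trapezoidal_error)
  \<comment> \<open>The primal equation removes \<open>A u z\<close> at the endpoint 1; at 0 the
    term \<open>- A u' z'\<close> is the residual, with a plus sign.\<close>
  moreover have "L 1 = J u" "L 0 = J u' + primal_residual A u' z'"
    using assms(3) by (simp_all add: L_def w_def y_def e_def es_def primal_residual_def)
  \<comment> \<open>The adjoint equation in direction \<open>e\<close> cancels the first two terms,
    the primal equation tested with \<open>es\<close> the third.\<close>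
  moreover have "L1 1 = 0"
    using assms(3,4) by (simp add: L1_def w_def y_def e_def es_def)
  moreover have "L1 0 = primal_residual A u' (z - z') + adjoint_residual A J u' z' (u - u')"
    by (simp add: L1_def w_def y_def e_def es_def primal_residual_def adjoint_residual_def)
  moreover have "1 / 2 * integral {0..1} (\<lambda>s. L3 s * (s * (s - 1))) = remainder3 A J u z u' z'"
    by (simp add: remainder3_def Let_def L3_def w_def y_def e_def es_def)
  ultimately show ?thesis
    by (simp add: field_simps)
qed

end
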